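(* Let $\mathcal{Q}=\{\mathrm{Ber}(p)^\infty:p\in(0,1)\}$. Every law $\mathtt{P}$ over the space $\{0,1\}^{\mathbb{N}}$ of binary sequences belongs to the closed fork-convex hull of $\mathcal{Q}$. Thus, the process $(M_t)$ with $M_t=1$ for all $t$ is the only $\mathcal{Q}$-NM, and every $\mathcal{Q}$-NSM must be nonincreasing in $t$; hence these never exceed one and always have zero power for any $\alpha\in(0,1)$: for every $\mathcal{Q}$-NSM $(M_t)$, every law $\mathtt{P}$ over binary sequences and every $\alpha\in(0,1)$, $\mathtt{P}(\inf\{t\ge1:M_t\ge1/\alpha\}<\infty)=0$.
   Context: $(X_t)_{t\ge1}$ are the coordinates on $\{0,1\}^{\mathbb{N}}$, $\mathcal{F}_0$ is trivial, $\mathcal{F}_t=\sigma(X_1,\dots,X_t)$. A $\mathcal{Q}$-NM (respectively $\mathcal{Q}$-NSM) is a nonnegative process $(M_t)_{t\ge0}$ adapted to $(\mathcal{F}_t)$ with $M_0=1$ and $\mathbb{E}_{\mathtt{Q}}[M_t\mid\mathcal{F}_s]=M_s$ (respectively $\le M_s$) for all $s\le t$ and every $\mathtt{Q}\in\mathcal{Q}$. The reference measure is $\mathtt{R}:=\mathrm{Ber}(1/2)^\infty$, which locally dominates every law $\mathtt{P}$ on $\{0,1\}^{\mathbb{N}}$, i.e. $\mathtt{P}|_{\mathcal{F}_t}\ll\mathtt{R}|_{\mathcal{F}_t}$ for all $t\in\mathbb{N}$; the likelihood ratio process of $\mathtt{P}$ is $Z_t=\mathrm{d}\mathtt{P}|_{\mathcal{F}_t}/\mathrm{d}\mathtt{R}|_{\mathcal{F}_t}$.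 A fork-convex combination of two laws $\mathtt{Q},\mathtt{Q}'$ with likelihood ratio processes $(Z_t),(Z'_t)$ is a law $\mathtt{Q}''$ with likelihood ratio process $$Z''_t=\begin{cases}Z_t,&t\le s,\\ hZ_t+(1-h)Z_s\dfrac{Z'_t}{Z'_s},&t>s,\end{cases}$$ for some $s\in\{0,1,2,\dots\}$ and some $\mathcal{F}_s$-measurable random variable $h$ with values in $[0,1]$ and $h=1$ on $\{Z'_s=0\}$ (with the convention $0/0:=1$). A set of laws is fork-convex if it contains every fork-convex combination of its elements. The fork-convex hull of a set is the intersection of all fork-convex sets containing it. The closed fork-convex hull is the closure of the fork-convex hull with respect to $L^1(\mathtt{R})$ convergence of the likelihood ratio processes at each fixed time $t\in\mathbb{N}$. *)

theory Defs
  imports "HOL-Probability.Probability"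
begin

text \<open>A binary sequence \<open>(x\<^sub>1, x\<^sub>2, \<dots>)\<close> is a function \<open>\<omega> :: nat \<Rightarrow> bool\<close> with \<open>\<omega> i = x\<^sub>i\<^sub>+\<^sub>1\<close>
  (\<open>True\<close> encodes \<open>1\<close>), so that the coordinates \<open>X t\<close> are meaningful for \<open>t \<ge> 1\<close>.\<close>

type_synonym bseq = "nat \<Rightarrow> bool"

definition bseq_space :: "bseq measure" where
  "bseq_space = PiM UNIV (\<lambda>_. count_space UNIV)"

definition X :: "nat \<Rightarrow> bseq \<Rightarrow> bool" where
  "X t \<omega> = \<omega> (t - 1)"

definition Filt :: "nat \<Rightarrow> bseq measure" where
  "Filt t = sigma UNIV {X i -` A | i A. 1 \<le> i \<and> i \<le> t}"

definition laws :: "bseq measure set" where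
  "laws = {P. prob_space P \<and> sets P = sets bseq_space}"

definition Ber_inf :: "real \<Rightarrow> bseq measure" where
  "Ber_inf p = PiM UNIV (\<lambda>_. measure_pmf (bernoulli_pmf p))"

abbreviation Ref :: "bseq measure" where
  "Ref \<equiv> Ber_inf (1/2)"

text \<open>Conditional expectations of nonnegative processes are taken in \<open>[0, \<infinity>]\<close>; integrability of
  \<open>M t\<close> is then a consequence of the condition for \<open>s = 0\<close>.\<close>

definition nonneg_unit_process :: "(nat \<Rightarrow> bseq \<Rightarrow> real) \<Rightarrow> bool" where
  "nonneg_unit_process M \<longleftrightarrow>
     (\<forall>t. M t \<in> borel_measurable (Filt t)) \<and> (\<forall>t \<omega>. 0 \<le> M t \<omega>) \<and> (\<forall>\<omega>. M 0 \<omega> = 1)"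

definition is_NM :: "bseq measure set \<Rightarrow> (nat \<Rightarrow> bseq \<Rightarrow> real) \<Rightarrow> bool" where
  "is_NM \<Q> M \<longleftrightarrow> nonneg_unit_process M \<and>
     (\<forall>Q\<in>\<Q>. \<forall>s t. s \<le> t \<longrightarrow>
        (AE \<omega> in Q. nn_cond_exp Q (Filt s) (\<lambda>\<omega>. ennreal (M t \<omega>)) \<omega> = ennreal (M s \<omega>)))"

definition is_NSM :: "bseq measure set \<Rightarrow> (nat \<Rightarrow> bseq \<Rightarrow> real) \<Rightarrow> bool" where
  "is_NSM \<Q> M \<longleftrightarrow> nonneg_unit_process M \<and>
     (\<forall>Q\<in>\<Q>. \<forall>s t. s \<le> t \<longrightarrow>
        (AE \<omega> in Q. nn_cond_exp Q (Filt s) (\<lambda>\<omega>. ennreal (M t \<omega>)) \<omega> \<le> ennreal (M s \<omega>)))"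

definition LR :: "bseq measure \<Rightarrow> nat \<Rightarrow> bseq \<Rightarrow> real" where
  "LR P t \<omega> = enn2real (RN_deriv (restr_to_subalg Ref (Filt t)) (restr_to_subalg P (Filt t)) \<omega>)"

text \<open>Division with the convention \<open>0/0 = 1\<close>.\<close>

definition quot :: "real \<Rightarrow> real \<Rightarrow> real" where
  "quot a b = (if a = 0 \<and> b = 0 then 1 else a / b)"

definition fork_combination :: "bseq measure \<Rightarrow> bseq measure \<Rightarrow> bseq measure \<Rightarrow> bool" where
  "fork_combination Q Q' Q'' \<longleftrightarrow> Q'' \<in> laws \<and>
     (\<exists>s. \<exists>h \<in> borel_measurable (Filt s).
        (\<forall>\<omega>. 0 \<le> h \<omega> \<and> h \<omega> \<le> (1::real)) \<and>
        (\<forall>\<omega>. LR Q' s \<omega> = 0 \<longrightarrow> h \<omega> = 1) \<and>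
        (\<forall>t. AE \<omega> in Ref. LR Q'' t \<omega> =
           (if t \<le> s then LR Q t \<omega>
            else h \<omega> * LR Q t \<omega> + (1 - h \<omega>) * LR Q s \<omega> * quot (LR Q' t \<omega>) (LR Q' s \<omega>))))"

definition fork_convex :: "bseq measure set \<Rightarrow> bool" where
  "fork_convex C \<longleftrightarrow> C \<subseteq> laws \<and>
     (\<forall>Q\<in>C. \<forall>Q'\<in>C. \<forall>Q''. fork_combination Q Q' Q'' \<longrightarrow> Q'' \<in> C)"

text \<open>The topology of \<open>L\<^sup>1(Ref)\<close> convergence of \<open>LR _ t\<close> for each fixed \<open>t\<close> is induced by
  countably many pseudometrics, so the closure of a set consists of the limits of its sequences.\<close>

definition LR_closure :: "bseq measure set \<Rightarrow> bseq measure set" where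
  "LR_closure C = {P \<in> laws. \<exists>S. (\<forall>n. S n \<in> C) \<and>
     (\<forall>t. (\<lambda>n. \<integral>\<^sup>+ \<omega>. ennreal \<bar>LR (S n) t \<omega> - LR P t \<omega>\<bar> \<partial>Ref) \<longlonglongrightarrow> 0)}"

definition closed_fork_convex_hull :: "bseq measure set \<Rightarrow> bseq measure set" where
  "closed_fork_convex_hull \<Q> = LR_closure (fork_convex hull \<Q>)"

lemma sets_Ber_inf: "sets (Ber_inf p) = sets bseq_space"
  unfolding Ber_inf_def bseq_space_def by (rule sets_PiM_cong) auto

lemma Ber_inf_in_laws: "Ber_inf p \<in> laws"
  using sets_Ber_inf by (auto simp: laws_def Ber_inf_def intro!: prob_space_PiM measure_pmf.prob_space_axioms)

lemma space_bseq_space: "space bseq_space = UNIV"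
  by (simp add: bseq_space_def space_PiM)

lemma space_Filt: "space (Filt t) = UNIV"
  by (simp add: Filt_def)

lemma sets_Filt: "sets (Filt t) = sigma_sets UNIV {X i -` A | i A. 1 \<le> i \<and> i \<le> t}"
  by (simp add: Filt_def)

lemma sets_Filt_0: "sets (Filt 0) = {{}, UNIV}"
  by (auto simp: sets_Filt sigma_sets_empty_eq)

lemma subalgebra_Filt:
  assumes "P \<in> laws"
  shows "subalgebra P (Filt t)"
proof -
  have P: "sets P = sets bseq_space" using assms by (simp add: laws_def)
  hence sp: "space P = UNIV" using sets_eq_imp_space_eq space_bseq_space by metis
  have X: "X i -` A \<in> sets bseq_space" for i A
  proof -
    have "X i \<in> measurable bseq_space (count_space UNIV)"
      unfolding X_def bseq_space_def by measurable
    from measurable_sets[OF this, of A] show ?thesis by (simp add: space_bseq_space)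
  qed
  have "sets (Filt t) \<subseteq> sets bseq_space"
    unfolding sets_Filt
    using sets.sigma_sets_subset[of "{X i -` A | i A. 1 \<le> i \<and> i \<le> t}" bseq_space] X
    by (auto simp: space_bseq_space)
  thus ?thesis using P sp by (simp add: subalgebra_def space_Filt)
qed

lemma Filt_cylinder:
  assumes "A \<in> sets (Filt t)" "\<omega> \<in> A" "\<And>i. i < t \<Longrightarrow> \<omega>' i = \<omega> i"
  shows "\<omega>' \<in> A"
proof -
  have "\<forall>\<omega> \<omega>'. (\<forall>i<t. \<omega>' i = \<omega> i) \<longrightarrow> (\<omega> \<in> A \<longleftrightarrow> \<omega>' \<in> A)"
    using assms(1) unfolding sets_Filt
  proof (induction rule: sigma_sets.induct)
    case (Basic a)
    then obtain i B where "a = X i -` B" "1 \<le> i" "i \<le> t" by auto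
    thus ?case by (auto simp: X_def)
  next
    case Empty then show ?case by simp
  next
    case (Compl a) then show ?case by blast
  next
    case (Union a) then show ?case by blast
  qed
  thus ?thesis using assms(2,3) by blast
qed

lemma Ref_cylinder: "emeasure Ref {\<omega>'. \<forall>i<t. \<omega>' i = \<omega> i} = (1/2) ^ t"
proof -
  interpret product_prob_space "\<lambda>_::nat. measure_pmf (bernoulli_pmf (1/2))" UNIV
    by unfold_locales
  have eq: "{\<omega>'. \<forall>i<t. \<omega>' i = \<omega> i} =
      prod_emb UNIV (\<lambda>_. measure_pmf (bernoulli_pmf (1/2))) {..<t} (PiE {..<t} (\<lambda>i. {\<omega> i}))"
    by (auto simp: prod_emb_def space_PiM PiE_def Pi_def extensional_def)
  have "emeasure Ref {\<omega>'. \<forall>i<t. \<omega>' i = \<omega> i} =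
      (\<Prod>i<t. emeasure (measure_pmf (bernoulli_pmf (1/2))) {\<omega> i})"
    unfolding eq Ber_inf_def by (rule emeasure_PiM_emb) auto
  also have "\<dots> = (\<Prod>i<t. 1/2)"
  proof (rule prod.cong)
    fix i
    show "emeasure (measure_pmf (bernoulli_pmf (1/2))) {\<omega> i} = 1/2"
      by (cases "\<omega> i") (simp_all add: emeasure_pmf_single divide_ennreal_def)
  qed simp
  finally show ?thesis by simp
qed

text \<open>\<open>Ref\<close> locally dominates every law, so \<open>LR\<close> is a genuine density process, and it has only
  one version.\<close>

lemma Filt_null_imp_empty:
  assumes "A \<in> sets (Filt t)" "emeasure Ref A = 0"
  shows "A = {}"
proof (rule ccontr)
  assume "A \<noteq> {}"
  then obtain \<omega> where w: "\<omega> \<in> A" by blast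
  have sub: "{\<omega>'. \<forall>i<t. \<omega>' i = \<omega> i} \<subseteq> A"
    using Filt_cylinder[OF assms(1) w] by blast
  have "A \<in> sets Ref"
    using subalgebra_Filt[OF Ber_inf_in_laws] assms(1) by (auto simp: subalgebra_def)
  from emeasure_mono[OF sub this] have "((1::ennreal)/2) ^ t \<le> 0"
    using assms(2) by (simp add: Ref_cylinder)
  thus False by (simp add: ennreal_divide_eq_0_iff)
qed

lemma Ref_locally_dominates:
  assumes "P \<in> laws"
  shows "absolutely_continuous (restr_to_subalg Ref (Filt t)) (restr_to_subalg P (Filt t))"
  unfolding absolutely_continuous_def
proof
  fix A assume A: "A \<in> null_sets (restr_to_subalg Ref (Filt t))"
  have s: "subalgebra Ref (Filt t)" by (rule subalgebra_Filt[OF Ber_inf_in_laws])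
  have "A \<in> sets (Filt t)" "emeasure Ref A = 0"
    using A s by (auto simp: null_sets_def sets_restr_to_subalg emeasure_restr_to_subalg)
  hence "A = {}" by (rule Filt_null_imp_empty)
  thus "A \<in> null_sets (restr_to_subalg P (Filt t))" by simp
qed

end

theory Submission
  imports Defs
begin

text \<open>Every atom of \<open>Filt t\<close> is a cylinder of positive \<open>Ref\<close>-measure, so likelihood ratios are
  everywhere determined by cylinder probabilities.  To approximate a law \<open>P\<close>, let a law run as
  \<open>Ber_inf e\<close> from time \<open>s\<close> on and fork it at time \<open>s\<close> towards \<open>Ber_inf (1 - e)\<close>, with weight
  \<open>h = 1 - q\<close> where \<open>q\<close> is the conditional probability under \<open>P\<close> that the next bit is \<open>1\<close>: the next bit
  is then \<open>1\<close> with probability \<open>q (1 - e) + (1 - q) e\<close>.  A second fork at time \<open>s + 1\<close> with \<open>h = 0\<close>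
  resets the future to \<open>Ber_inf e\<close>.  Iterating and letting \<open>e\<close> tend to \<open>0\<close> yields \<open>P\<close>.

  For a supermartingale \<open>M\<close> and an initial segment \<open>w\<close> of length \<open>s\<close>, the condition for \<open>Ber_inf p\<close> reads
  \<open>p M\<^sub>s\<^sub>+\<^sub>1(w1) + (1 - p) M\<^sub>s\<^sub>+\<^sub>1(w0) \<le> M\<^sub>s(w)\<close>; letting \<open>p\<close> tend to \<open>1\<close> and to \<open>0\<close> shows
  that \<open>M\<close> cannot increase along any path.\<close>

section \<open>Cylinder sets and their probabilities\<close>

text \<open>The index set \<open>J\<close> is arbitrary because a fork at time \<open>s\<close>
  involves both the past \<open>{..<s}\<close> and the segment \<open>{s..<t}\<close>.\<close>

definition cyl :: "nat set \<Rightarrow> bseq \<Rightarrow> bseq set" where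
  "cyl J w = {\<omega>. \<forall>i\<in>J. \<omega> i = w i}"

lemma mem_cyl: "\<omega> \<in> cyl J w \<longleftrightarrow> (\<forall>i\<in>J. \<omega> i = w i)"
  by (simp add: cyl_def)

lemma cyl_cong: "(\<And>i. i \<in> J \<Longrightarrow> w i = w' i) \<Longrightarrow> cyl J w = cyl J w'"
  by (auto simp: cyl_def)

lemma cyl_empty: "cyl {} w = UNIV"
  by (simp add: cyl_def)

lemma sets_cyl [measurable]: "finite J \<Longrightarrow> cyl J w \<in> sets bseq_space"
proof -
  assume "finite J"
  have "{\<omega> \<in> space bseq_space. \<forall>i\<in>J. \<omega> i = w i} \<in> sets bseq_space"
    unfolding bseq_space_def using \<open>finite J\<close> by measurable
  thus ?thesis by (simp add: cyl_def space_bseq_space)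
qed

lemma laws_space: "P \<in> laws \<Longrightarrow> space P = UNIV"
  using sets_eq_imp_space_eq[of P bseq_space] by (simp add: laws_def space_bseq_space)

lemma laws_sets: "P \<in> laws \<Longrightarrow> sets P = sets bseq_space"
  by (simp add: laws_def)

lemma laws_prob_space: "P \<in> laws \<Longrightarrow> prob_space P"
  by (simp add: laws_def)

lemma emeasure_Ber_inf_cyl:
  assumes "finite J"
  shows "emeasure (Ber_inf p) (cyl J w) = ennreal (\<Prod>i\<in>J. pmf (bernoulli_pmf p) (w i))"
proof -
  interpret product_prob_space "\<lambda>_::nat. measure_pmf (bernoulli_pmf p)" UNIV
    by unfold_locales
  have eq: "cyl J w =
      prod_emb UNIV (\<lambda>_. measure_pmf (bernoulli_pmf p)) J (PiE J (\<lambda>i. {w i}))"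
    by (auto simp: prod_emb_def space_PiM PiE_def Pi_def extensional_def cyl_def)
  have "emeasure (Ber_inf p) (cyl J w) =
      (\<Prod>i\<in>J. emeasure (measure_pmf (bernoulli_pmf p)) {w i})"
    unfolding eq Ber_inf_def using assms by (intro emeasure_PiM_emb) auto
  also have "\<dots> = ennreal (\<Prod>i\<in>J. pmf (bernoulli_pmf p) (w i))"
    by (simp add: emeasure_pmf_single prod_ennreal)
  finally show ?thesis .
qed

lemma measure_Ber_inf_cyl:
  assumes "finite J"
  shows "measure (Ber_inf p) (cyl J w) = (\<Prod>i\<in>J. pmf (bernoulli_pmf p) (w i))"
  unfolding measure_def emeasure_Ber_inf_cyl[OF assms] by (simp add: prod_nonneg)

section \<open>The filtration and likelihood ratios in terms of cylinders\<close>

text \<open>Prefixes of length \<open>t\<close> are coded as lists of bits, a countable type, so a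
  union of prefix cylinders over any set of sequences is a countable union of members of
  \<open>Filt t\<close>.\<close>

lemma sets_Filt_iff:
  "A \<in> sets (Filt t) \<longleftrightarrow> (\<forall>\<omega>\<in>A. cyl {..<t} \<omega> \<subseteq> A)"
proof
  assume "A \<in> sets (Filt t)"
  thus "\<forall>\<omega>\<in>A. cyl {..<t} \<omega> \<subseteq> A"
    using Filt_cylinder[of A t] unfolding cyl_def by blast
next
  assume A: "\<forall>\<omega>\<in>A. cyl {..<t} \<omega> \<subseteq> A"
  define pre where "pre = (\<lambda>\<omega>::bseq. map \<omega> [0..<t])"
  have pre_eq: "pre \<omega> = pre \<omega>' \<longleftrightarrow> \<omega>' \<in> cyl {..<t} \<omega>" for \<omega> \<omega>'
    by (auto simp: pre_def cyl_def)
  have cyl: "cyl {..<t} w \<in> sets (Filt t)" for w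
  proof -
    have "X (Suc i) -` {w i} \<in> sets (Filt t)" if "i < t" for i
    proof -
      have "X (Suc i) -` {w i} \<in> {X i -` A | i A. 1 \<le> i \<and> i \<le> t}"
        using that by (intro CollectI exI[of _ "Suc i"] exI[of _ "{w i}"]) simp
      thus ?thesis unfolding sets_Filt by (rule sigma_sets.Basic)
    qed
    moreover have "X (Suc i) -` {w i} = {\<omega> \<in> space (Filt t). \<omega> i = w i}" for i
      by (intro set_eqI) (simp add: X_def space_Filt)
    ultimately have "{\<omega> \<in> space (Filt t). \<omega> i = w i} \<in> sets (Filt t)" if "i < t" for i
      using that by metis
    hence "{\<omega> \<in> space (Filt t). \<forall>i\<in>{..<t}. \<omega> i = w i} \<in> sets (Filt t)"
      by (intro sets.sets_Collect_finite_All) (simp_all only: lessThan_iff finite_lessThan)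
    thus ?thesis by (simp add: cyl_def space_Filt)
  qed
  have "(\<Union>l\<in>pre ` A. {\<omega>. pre \<omega> = l}) \<in> sets (Filt t)"
  proof (rule sets.countable_UN')
    show "countable (pre ` A)" by simp
    show "(\<lambda>l. {\<omega>. pre \<omega> = l}) ` pre ` A \<subseteq> sets (Filt t)"
    proof clarify
      fix w assume "w \<in> A"
      have "{\<omega>. pre \<omega> = pre w} = cyl {..<t} w" using pre_eq[of w] by (intro set_eqI) (simp add: eq_commute)
      thus "{\<omega>. pre \<omega> = pre w} \<in> sets (Filt t)" using cyl by simp
    qed
  qed
  also have "(\<Union>l\<in>pre ` A. {\<omega>. pre \<omega> = l}) = A"
  proof (intro set_eqI iffI)
    fix \<omega> assume "\<omega> \<in> (\<Union>l\<in>pre ` A. {\<omega>. pre \<omega> = l})"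
    then obtain w where "w \<in> A" "pre w = pre \<omega>" by (auto simp: eq_commute)
    thus "\<omega> \<in> A" using A pre_eq by blast
  qed auto
  finally show "A \<in> sets (Filt t)" .
qed

lemma sets_Filt_cyl: "cyl {..<t} w \<in> sets (Filt t)"
  by (auto simp: sets_Filt_iff cyl_def)

text \<open>In a T1 space the singleton \<open>{f w}\<close> is closed, so its preimage lies in
  \<open>Filt t\<close> and contains the whole cylinder of \<open>w\<close>. This serves real and
  extended nonnegative values alike.\<close>

lemma measurable_FiltD:
  fixes f :: "bseq \<Rightarrow> 'b::t1_space"
  assumes "f \<in> borel_measurable (Filt t)" "\<omega> \<in> cyl {..<t} w"
  shows "f \<omega> = f w"
proof -
  have "f -` {f w} \<inter> space (Filt t) \<in> sets (Filt t)"
    by (rule measurable_sets[OF assms(1)]) simp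
  thus ?thesis using assms(2) by (auto simp: sets_Filt_iff space_Filt)
qed

lemma measurable_FiltI:
  assumes "\<And>w \<omega>. \<omega> \<in> cyl {..<t} w \<Longrightarrow> f \<omega> = f w" "\<And>\<omega>. f \<omega> \<in> space N"
  shows "f \<in> measurable (Filt t) N"
proof (rule measurableI)
  fix A
  show "f -` A \<inter> space (Filt t) \<in> sets (Filt t)"
    unfolding sets_Filt_iff using assms(1) by (auto simp: space_Filt)
qed (use assms(2) in auto)

text \<open>The density is constant on the cylinder of \<open>w\<close>, an atom of
  \<open>Filt t\<close> of \<open>Ref\<close>-mass \<open>(1/2) ^ t\<close>, so its integral over
  that atom determines its value. Hence the identity holds everywhere, not just almost
  everywhere.\<close>

lemma LR_eq:
  assumes P: "P \<in> laws"
  shows "LR P t w = 2 ^ t * measure P (cyl {..<t} w)"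
proof -
  let ?R = "restr_to_subalg Ref (Filt t)" and ?N = "restr_to_subalg P (Filt t)"
  let ?A = "cyl {..<t} w"
  have sR: "subalgebra Ref (Filt t)" and sP: "subalgebra P (Filt t)"
    using subalgebra_Filt Ber_inf_in_laws P by auto
  interpret R: prob_space ?R
    by (rule prob_space_restr_to_subalg[OF sR laws_prob_space[OF Ber_inf_in_laws]])
  have f: "RN_deriv ?R ?N \<in> borel_measurable (Filt t)"
    by (rule measurable_in_subalg'[OF sR borel_measurable_RN_deriv])
  have A: "?A \<in> sets (Filt t)" by (rule sets_Filt_cyl)
  have "density ?R (RN_deriv ?R ?N) = ?N"
    by (rule R.density_RN_deriv[OF Ref_locally_dominates[OF P]])
       (simp add: sets_restr_to_subalg[OF sR] sets_restr_to_subalg[OF sP])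
  hence "emeasure P ?A = emeasure (density ?R (RN_deriv ?R ?N)) ?A"
    using emeasure_restr_to_subalg[OF sP A] by simp
  also have "\<dots> = (\<integral>\<^sup>+x. RN_deriv ?R ?N x * indicator ?A x \<partial>?R)"
    by (rule emeasure_density) (use A in \<open>auto simp: sets_restr_to_subalg[OF sR]\<close>)
  also have "\<dots> = (\<integral>\<^sup>+x. RN_deriv ?R ?N w * indicator ?A x \<partial>?R)"
    by (intro nn_integral_cong) (auto split: split_indicator dest: measurable_FiltD[OF f])
  also have "\<dots> = RN_deriv ?R ?N w * emeasure ?R ?A"
    by (rule nn_integral_cmult_indicator) (use A in \<open>simp add: sets_restr_to_subalg[OF sR]\<close>)
  also have "emeasure ?R ?A = (1/2) ^ t"
    using emeasure_restr_to_subalg[OF sR A] Ref_cylinder[where \<omega> = w and t = t] by (simp add: cyl_def lessThan_def)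
  \<comment> \<open>The mass of the cylinder is known both as a real and as an extended real;
    comparing the two evaluates \<open>enn2real\<close>.\<close>
  moreover have half: "enn2real ((1/2) ^ t) = (1/2) ^ t"
    using measure_Ber_inf_cyl[of "{..<t}" "1/2" w] Ref_cylinder[where \<omega> = w and t = t]
    by (simp add: measure_def cyl_def lessThan_def)
  ultimately have "measure P ?A = LR P t w * (1/2) ^ t"
    by (simp add: measure_def LR_def enn2real_mult half)
  thus ?thesis by (simp add: power_divide)
qed


section \<open>Construction of forked laws\<close>

definition graft :: "nat \<Rightarrow> bseq \<Rightarrow> bseq \<Rightarrow> bseq" where
  "graft s \<omega> \<omega>' = (\<lambda>i. if i < s then \<omega> i else \<omega>' i)"

text \<open>The law is realised by running \<open>Q\<close>, \<open>B\<close> independently together with an \<open>h\<close>-coin \<open>b\<close>, which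
  decides whether the path of \<open>Q\<close> is continued by that of \<open>B\<close> from time \<open>s\<close> on.\<close>

lemma exists_fork_law:
  assumes Q: "Q \<in> laws" and B: "B \<in> laws" and h: "h \<in> borel_measurable (Filt s)"
    and h01: "\<And>\<omega>. 0 \<le> h \<omega> \<and> h \<omega> \<le> (1::real)"
  obtains R where "R \<in> laws"
    "\<And>t w. t \<le> s \<Longrightarrow> measure R (cyl {..<t} w) = measure Q (cyl {..<t} w)"
    "\<And>t w. s < t \<Longrightarrow> measure R (cyl {..<t} w) =
       h w * measure Q (cyl {..<t} w) + (1 - h w) * measure Q (cyl {..<s} w) * measure B (cyl {s..<t} w)"
proof -
  interpret Q: prob_space Q using Q by (rule laws_prob_space)
  interpret B: prob_space B using B by (rule laws_prob_space)
  note [measurable_cong] = laws_sets[OF Q] laws_sets[OF B]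
  have hQ [measurable]: "h \<in> borel_measurable Q"
    by (rule measurable_from_subalg[OF subalgebra_Filt[OF Q] h])
  define C where "C = (count_space UNIV :: bool measure)"
  define K where "K = Q \<Otimes>\<^sub>M (B \<Otimes>\<^sub>M C)"
  define T where "T = (\<lambda>(\<omega>, \<omega>', b). if b then \<omega> else graft s \<omega> \<omega>')"
  \<comment> \<open>The coin is a density against counting measure because its bias depends on the
    path \<omega>.\<close>
  define g where "g = (\<lambda>(\<omega>, \<omega>'::bseq, b). ennreal (if b then h \<omega> else 1 - h \<omega>))"
  have graft [measurable]: "(\<lambda>(\<omega>, \<omega>'). graft s \<omega> \<omega>') \<in> measurable (bseq_space \<Otimes>\<^sub>M bseq_space) bseq_space"
  proof -
    have "(\<lambda>z. graft s (fst z) (snd z) i) \<in> measurable (bseq_space \<Otimes>\<^sub>M bseq_space) (count_space UNIV)" for i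
      unfolding graft_def bseq_space_def by (cases "i < s") simp_all
    hence "(\<lambda>z i. graft s (fst z) (snd z) i) \<in> measurable (bseq_space \<Otimes>\<^sub>M bseq_space)
        (PiM UNIV (\<lambda>_. count_space UNIV))"
      by (intro measurable_PiM_single') auto
    thus ?thesis by (simp add: bseq_space_def case_prod_beta' )
  qed
  have T [measurable]: "T \<in> measurable K bseq_space"
    unfolding T_def K_def C_def by measurable
  have g [measurable]: "g \<in> borel_measurable K"
    unfolding g_def K_def C_def by measurable
  define R where "R = distr (density K g) bseq_space T"
  interpret C: sigma_finite_measure C
    unfolding C_def by (rule sigma_finite_measure_count_space_countable) simp
  have C: "integral\<^sup>N C F = F True + F False" for F
    unfolding C_def by (subst nn_integral_count_space_finite) (simp_all add: UNIV_bool add.commute)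
  interpret BC: pair_sigma_finite B C ..
  have emR: "emeasure R A = (\<integral>\<^sup>+\<omega>. \<integral>\<^sup>+\<omega>'. ennreal (h \<omega>) * indicator A \<omega> +
      ennreal (1 - h \<omega>) * indicator A (graft s \<omega> \<omega>') \<partial>B \<partial>Q)"
    if A [measurable]: "A \<in> sets bseq_space" for A
  proof -
    have "emeasure R A = (\<integral>\<^sup>+z. indicator A z \<partial>R)"
      by (rule nn_integral_indicator[symmetric]) (simp add: R_def A)
    also have "\<dots> = (\<integral>\<^sup>+z. indicator A (T z) \<partial>density K g)"
      unfolding R_def by (rule nn_integral_distr) simp_all
    also have "\<dots> = (\<integral>\<^sup>+z. g z * indicator A (T z) \<partial>K)"
      by (rule nn_integral_density) simp_all
    also have "\<dots> = (\<integral>\<^sup>+\<omega>. \<integral>\<^sup>+z. g (\<omega>, z) * indicator A (T (\<omega>, z)) \<partial>(B \<Otimes>\<^sub>M C) \<partial>Q)"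
      unfolding K_def by (rule BC.P.nn_integral_fst[symmetric]) (simp add: K_def[symmetric])
    also have "\<dots> = (\<integral>\<^sup>+\<omega>. \<integral>\<^sup>+\<omega>'. \<integral>\<^sup>+b. g (\<omega>, \<omega>', b) * indicator A (T (\<omega>, \<omega>', b)) \<partial>C \<partial>B \<partial>Q)"
    proof (rule nn_integral_cong)
      fix \<omega> assume "\<omega> \<in> space Q"
      hence [measurable]: "(\<lambda>z. (\<omega>, z)) \<in> measurable (B \<Otimes>\<^sub>M C) K"
        unfolding K_def by simp
      show "(\<integral>\<^sup>+z. g (\<omega>, z) * indicator A (T (\<omega>, z)) \<partial>(B \<Otimes>\<^sub>M C)) =
          (\<integral>\<^sup>+\<omega>'. \<integral>\<^sup>+b. g (\<omega>, \<omega>', b) * indicator A (T (\<omega>, \<omega>', b)) \<partial>C \<partial>B)"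
        by (rule C.nn_integral_fst[symmetric]) measurable
    qed
    also have "(\<lambda>\<omega> \<omega>'. \<integral>\<^sup>+b. g (\<omega>, \<omega>', b) * indicator A (T (\<omega>, \<omega>', b)) \<partial>C) =
        (\<lambda>\<omega> \<omega>'. ennreal (h \<omega>) * indicator A \<omega> + ennreal (1 - h \<omega>) * indicator A (graft s \<omega> \<omega>'))"
      unfolding C g_def T_def by simp
    finally show ?thesis .
  qed
  have h_sum: "ennreal (h \<omega>) + ennreal (1 - h \<omega>) = 1" for \<omega>
    using h01[of \<omega>] ennreal_plus[of "h \<omega>" "1 - h \<omega>"] by simp
  have le: "measure R (cyl {..<t} w) = measure Q (cyl {..<t} w)" if "t \<le> s" for t w
  proof -
    let ?A = "cyl {..<t} w"
    \<comment> \<open>Grafting at \<open>s\<close> leaves the first \<open>t\<close> bits alone when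
      \<open>t \<le> s\<close>, so both branches have the same indicator and their weights add up to
      1.\<close>
    have *: "ennreal (h \<omega>) * indicator ?A \<omega> + ennreal (1 - h \<omega>) * indicator ?A (graft s \<omega> \<omega>')
        = indicator ?A \<omega>" for \<omega> \<omega>'
    proof -
      have "(indicator ?A (graft s \<omega> \<omega>') :: ennreal) = indicator ?A \<omega>"
        using that by (auto simp: cyl_def graft_def indicator_def)
      thus ?thesis by (metis h_sum distrib_right mult_1)
    qed
    have "emeasure R ?A = emeasure Q ?A"
      unfolding emR[OF sets_cyl[OF finite_lessThan]] *
      by (simp add: B.emeasure_space_1 laws_sets[OF Q] sets_cyl)
    thus ?thesis by (simp add: measure_def)
  qed
  have gt: "measure R (cyl {..<t} w) =
       h w * measure Q (cyl {..<t} w) + (1 - h w) * measure Q (cyl {..<s} w) * measure B (cyl {s..<t} w)"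
    if "s < t" for t w
  proof -
    let ?A = "cyl {..<t} w"
    \<comment> \<open>Both branches force \<omega> to agree with \<open>w\<close> before
      \<open>s\<close>, where \<open>h \<omega> = h w\<close>. The grafted branch splits into a
      condition on each of the two paths, so the double integral factorises.\<close>
    have *: "ennreal (h \<omega>) * indicator ?A \<omega> + ennreal (1 - h \<omega>) * indicator ?A (graft s \<omega> \<omega>')
        = ennreal (h w) * indicator ?A \<omega> +
          ennreal (1 - h w) * indicator (cyl {..<s} w) \<omega> * indicator (cyl {s..<t} w) \<omega>'" for \<omega> \<omega>'
    proof (cases "\<omega> \<in> cyl {..<s} w")
      case True
      moreover have "graft s \<omega> \<omega>' \<in> ?A \<longleftrightarrow> \<omega>' \<in> cyl {s..<t} w"
        using True that by (auto simp: cyl_def graft_def not_less)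
      ultimately show ?thesis using measurable_FiltD[OF h True] by (auto simp: indicator_def)
    next
      case False
      hence "\<omega> \<notin> ?A" "graft s \<omega> \<omega>' \<notin> ?A"
        using that by (force simp: cyl_def graft_def)+
      with False show ?thesis by simp
    qed
    have "emeasure R ?A = ennreal (h w) * emeasure Q ?A +
        ennreal (1 - h w) * emeasure Q (cyl {..<s} w) * emeasure B (cyl {s..<t} w)"
    proof -
      note [measurable] = sets_cyl
      have "emeasure R ?A = (\<integral>\<^sup>+\<omega>. ennreal (h w) * indicator ?A \<omega> +
          ennreal (1 - h w) * indicator (cyl {..<s} w) \<omega> * emeasure B (cyl {s..<t} w) \<partial>Q)"
        unfolding emR[OF sets_cyl[OF finite_lessThan]] *
        by (subst nn_integral_add)
           (simp_all add: nn_integral_cmult_indicator laws_sets[OF B] sets_cyl B.emeasure_space_1)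
      also have "\<dots> = (\<integral>\<^sup>+\<omega>. ennreal (h w) * indicator ?A \<omega> \<partial>Q) +
          (\<integral>\<^sup>+\<omega>. ennreal (1 - h w) * indicator (cyl {..<s} w) \<omega> \<partial>Q) * emeasure B (cyl {s..<t} w)"
        by (subst nn_integral_add) (simp_all add: nn_integral_multc)
      finally show ?thesis
        by (simp add: nn_integral_cmult_indicator laws_sets[OF Q] sets_cyl)
    qed
    also have "\<dots> = ennreal (h w * measure Q ?A +
        (1 - h w) * measure Q (cyl {..<s} w) * measure B (cyl {s..<t} w))"
      using h01[of w]
      by (simp add: Q.emeasure_eq_measure B.emeasure_eq_measure ennreal_mult ennreal_plus)
    finally show ?thesis
      using h01[of w] by (intro measure_eq_emeasure_eq_ennreal) auto
  qed
  have "prob_space R"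
  proof
    \<comment> \<open>This is the first identity at \<open>t = 0\<close>: the cylinder over no
      coordinates is the whole space.\<close>
    have "measure R UNIV = 1"
      using le[of 0 undefined] Q.prob_space by (simp add: cyl_empty laws_space[OF Q])
    moreover have "space R = UNIV" by (simp add: R_def space_bseq_space)
    ultimately show "emeasure R (space R) = 1"
      by (cases "emeasure R UNIV") (auto simp: measure_def)
  qed
  hence "R \<in> laws" by (simp add: laws_def R_def)
  from that[OF this le gt] show ?thesis by blast
qed

lemma measure_Ber_inf_cyl_pos:
  assumes "0 < p" "p < 1" "finite J"
  shows "0 < measure (Ber_inf p) (cyl J w)"
  unfolding measure_Ber_inf_cyl[OF assms(3)]
proof (rule prod_pos)
  show "0 < pmf (bernoulli_pmf p) (w i)" for i
    using assms(1,2) by (cases "w i") auto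
qed

lemma measure_Ber_inf_cyl_split:
  assumes "s \<le> t"
  shows "measure (Ber_inf p) (cyl {..<t} w) =
    measure (Ber_inf p) (cyl {..<s} w) * measure (Ber_inf p) (cyl {s..<t} w)"
  using assms by (simp add: measure_Ber_inf_cyl lessThan_atLeast0 prod.atLeastLessThan_concat)

text \<open>Under a product law the bits after \<open>s\<close> are independent of the past, so the
  quotient of likelihood ratios of \<open>Ber_inf p\<close> is \<open>2 ^ (t - s)\<close> times the
  probability of the segment \<open>{s..<t}\<close>. This is what grafting an independent path
  produces.\<close>

lemma exists_fork_combination:
  assumes Q: "Q \<in> laws" and p: "0 < p" "p < 1" and h: "h \<in> borel_measurable (Filt s)"
    and h01: "\<And>\<omega>. 0 \<le> h \<omega> \<and> h \<omega> \<le> (1::real)"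
  obtains R where "fork_combination Q (Ber_inf p) R"
    "\<And>t w. t \<le> s \<Longrightarrow> measure R (cyl {..<t} w) = measure Q (cyl {..<t} w)"
    "\<And>t w. s < t \<Longrightarrow> measure R (cyl {..<t} w) = h w * measure Q (cyl {..<t} w) +
       (1 - h w) * measure Q (cyl {..<s} w) * measure (Ber_inf p) (cyl {s..<t} w)"
proof -
  obtain R where R: "R \<in> laws" and
    le: "\<And>t w. t \<le> s \<Longrightarrow> measure R (cyl {..<t} w) = measure Q (cyl {..<t} w)" and
    gt: "\<And>t w. s < t \<Longrightarrow> measure R (cyl {..<t} w) = h w * measure Q (cyl {..<t} w) +
       (1 - h w) * measure Q (cyl {..<s} w) * measure (Ber_inf p) (cyl {s..<t} w)"
    using exists_fork_law[OF Q Ber_inf_in_laws h h01] by blast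
  note LRs = LR_eq[OF R] LR_eq[OF Q] LR_eq[OF Ber_inf_in_laws]
  have quot: "quot (LR (Ber_inf p) t w) (LR (Ber_inf p) s w) =
      2 ^ (t - s) * measure (Ber_inf p) (cyl {s..<t} w)" if "s < t" for t w
  proof -
    have "(2::real) ^ t = 2 ^ s * 2 ^ (t - s)" using that by (simp flip: power_add)
    thus ?thesis
      using measure_Ber_inf_cyl_pos[OF p, of "{..<s}" w] measure_Ber_inf_cyl_split[of s t p w] that
      by (simp add: quot_def LRs)
  qed
  have "LR R t w = (if t \<le> s then LR Q t w
      else h w * LR Q t w + (1 - h w) * LR Q s w * quot (LR (Ber_inf p) t w) (LR (Ber_inf p) s w))" for t w
  proof (cases "t \<le> s")
    case False
    hence "(2::real) ^ t = 2 ^ s * 2 ^ (t - s)" by (simp flip: power_add)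
    with False show ?thesis by (simp add: quot) (simp add: LRs gt algebra_simps)
  qed (simp add: LRs le)
  \<comment> \<open>The condition that \<open>h\<close> be 1 where this ratio vanishes holds because
    it never vanishes.\<close>
  moreover have "LR (Ber_inf p) s w \<noteq> 0" for w
    using measure_Ber_inf_cyl_pos[OF p, of "{..<s}" w] by (simp add: LRs)
  ultimately have "fork_combination Q (Ber_inf p) R"
    unfolding fork_combination_def using R h h01
    by (intro conjI exI[of _ s] bexI[of _ h]) auto
  from that[OF this le gt] show ?thesis by blast
qed

lemma fork_convex_laws: "fork_convex laws"
  by (simp add: fork_convex_def fork_combination_def)

text \<open>Every fork-convex set above \<Q> contains the hull, hence also each combination formed
  inside it; \<open>laws\<close> is one such set, which puts the hull inside
  \<open>laws\<close>.\<close>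

lemma fork_convex_hull_fork_convex:
  assumes "\<Q> \<subseteq> laws"
  shows "fork_convex (fork_convex hull \<Q>)"
proof -
  have "Q'' \<in> fork_convex hull \<Q>"
    if "Q \<in> fork_convex hull \<Q>" "Q' \<in> fork_convex hull \<Q>" "fork_combination Q Q' Q''" for Q Q' Q''
    unfolding hull_def
  proof (rule InterI)
    fix T assume "T \<in> {T. fork_convex T \<and> \<Q> \<subseteq> T}"
    hence T: "fork_convex T" "\<Q> \<subseteq> T" by auto
    hence "fork_convex hull \<Q> \<subseteq> T" by (simp add: hull_minimal)
    with that T(1) show "Q'' \<in> T" unfolding fork_convex_def by blast
  qed
  moreover have "fork_convex hull \<Q> \<subseteq> laws"
    using assms fork_convex_laws by (simp add: hull_minimal)
  ultimately show ?thesis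
    unfolding fork_convex_def[of "fork_convex hull \<Q>"] by blast
qed

section \<open>Approximation of an arbitrary law\<close>

text \<open>Overwriting \<open>w t\<close> makes the value depend only on the prefix before
  \<open>t\<close>. On a null prefix, division by zero gives 0, which still lies in the unit
  interval.\<close>

definition next_prob :: "bseq measure \<Rightarrow> nat \<Rightarrow> bseq \<Rightarrow> real" where
  "next_prob P t w = measure P (cyl {..<Suc t} (w(t := True))) / measure P (cyl {..<t} w)"

lemma cyl_Suc_upd: "cyl {..<Suc t} (w(t := b)) = {\<omega> \<in> cyl {..<t} w. \<omega> t = b}"
  by (auto simp: cyl_def less_Suc_eq)

lemma next_prob_bounds:
  assumes "P \<in> laws"
  shows "0 \<le> next_prob P t w" "next_prob P t w \<le> 1"
proof -
  interpret prob_space P using assms by (rule laws_prob_space)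
  have "prob (cyl {..<Suc t} (w(t := True))) \<le> prob (cyl {..<t} w)"
    by (rule finite_measure_mono) (auto simp: cyl_Suc_upd laws_sets[OF assms] sets_cyl)
  thus "next_prob P t w \<le> 1"
    unfolding next_prob_def by (cases "prob (cyl {..<t} w) = 0") (simp_all add: divide_le_eq_1_pos zero_less_measure_iff)
  show "0 \<le> next_prob P t w" by (simp add: next_prob_def)
qed

text \<open>The chain rule. It survives on null prefixes because both sides are 0 there, whatever
  the default value of \<open>next_prob\<close>.\<close>

lemma measure_cyl_Suc:
  assumes "P \<in> laws"
  shows "measure P (cyl {..<Suc t} w) =
    measure P (cyl {..<t} w) * (if w t then next_prob P t w else 1 - next_prob P t w)"
proof -
  interpret prob_space P using assms by (rule laws_prob_space)
  let ?T = "cyl {..<Suc t} (w(t := True))" and ?F = "cyl {..<Suc t} (w(t := False))"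
  have sets: "?T \<in> events" "?F \<in> events" by (simp_all only: laws_sets[OF assms] sets_cyl finite_lessThan)
  have "cyl {..<t} w = ?T \<union> ?F" by (auto simp: cyl_Suc_upd)
  moreover have "prob (?T \<union> ?F) = prob ?T + prob ?F"
    by (rule finite_measure_Union) (use sets in \<open>auto simp: cyl_Suc_upd\<close>)
  ultimately have sum: "prob (cyl {..<t} w) = prob ?T + prob ?F" by simp
  have T: "prob ?T = prob (cyl {..<t} w) * next_prob P t w"
  proof (cases "prob (cyl {..<t} w) = 0")
    case True
    hence "prob ?T = 0" using sum measure_nonneg[of P ?T] measure_nonneg[of P ?F] by linarith
    thus ?thesis using True by simp
  qed (simp add: next_prob_def)
  show ?thesis
  proof (cases "w t")
    case True
    hence "w(t := True) = w" by (simp add: fun_upd_idem)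
    thus ?thesis using T True by simp
  next
    case False
    hence "w(t := False) = w" by (simp add: fun_upd_idem)
    thus ?thesis using T False sum by (simp add: algebra_simps)
  qed
qed

text \<open>Prefix probabilities when each bit is drawn with the conditional probability of
  \<open>P\<close> given the bits produced so far and then flipped with probability
  \<open>e\<close>.\<close>

primrec approx_prob :: "bseq measure \<Rightarrow> real \<Rightarrow> nat \<Rightarrow> bseq \<Rightarrow> real" where
  "approx_prob P e 0 w = 1"
| "approx_prob P e (Suc t) w = approx_prob P e t w *
     (next_prob P t w * pmf (bernoulli_pmf (1 - e)) (w t) +
      (1 - next_prob P t w) * pmf (bernoulli_pmf e) (w t))"

text \<open>Induction on the number \<open>s\<close> of imitated bits, with two forks per step. For
  \<open>t \<le> s\<close> the segment \<open>{s..<t}\<close> is empty and contributes the factor 1,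
  so one formula with \<open>min s t\<close> covers short prefixes too.\<close>

lemma exists_approx_law:
  assumes C: "fork_convex C" and Ber: "\<And>p. 0 < p \<Longrightarrow> p < 1 \<Longrightarrow> Ber_inf p \<in> C"
    and P: "P \<in> laws" and e: "0 < e" "e < 1"
  shows "\<exists>S\<in>C. \<forall>t w. measure S (cyl {..<t} w) =
    approx_prob P e (min s t) w * measure (Ber_inf e) (cyl {s..<t} w)"
proof (induction s)
  case 0
  have "\<forall>t w. measure (Ber_inf e) (cyl {..<t} w) =
      approx_prob P e (min 0 t) w * measure (Ber_inf e) (cyl {0..<t} w)"
    by (simp add: lessThan_atLeast0)
  with Ber[OF e] show ?case by blast
next
  case (Suc s)
  then obtain S where S: "S \<in> C" and S_cyl: "\<And>t w. measure S (cyl {..<t} w) =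
      approx_prob P e (min s t) w * measure (Ber_inf e) (cyl {s..<t} w)" by blast
  have fork: "R \<in> C" if "fork_combination Q (Ber_inf p) R" "Q \<in> C" "0 < p" "p < 1" for Q p R
    using C Ber that unfolding fork_convex_def by blast
  have laws: "Q \<in> laws" if "Q \<in> C" for Q
    using C that unfolding fork_convex_def by blast
  \<comment> \<open>A fork at \<open>s\<close> needs a weight decided by the first \<open>s\<close>
    bits.\<close>
  have h: "(\<lambda>w. 1 - next_prob P s w) \<in> borel_measurable (Filt s)"
  proof (rule measurable_FiltI)
    fix w \<omega> assume *: "\<omega> \<in> cyl {..<s} w"
    have "cyl {..<s} \<omega> = cyl {..<s} w" "cyl {..<Suc s} (fun_upd \<omega> s True) = cyl {..<Suc s} (w(s := True))"
      using * by (auto simp: mem_cyl intro!: cyl_cong)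
    thus "1 - next_prob P s \<omega> = 1 - next_prob P s w" by (simp add: next_prob_def)
  qed simp
  obtain R where R: "fork_combination S (Ber_inf (1 - e)) R"
    and R_le: "\<And>t w. t \<le> s \<Longrightarrow> measure R (cyl {..<t} w) = measure S (cyl {..<t} w)"
    and R_gt: "\<And>t w. s < t \<Longrightarrow> measure R (cyl {..<t} w) =
       (1 - next_prob P s w) * measure S (cyl {..<t} w) +
       (1 - (1 - next_prob P s w)) * measure S (cyl {..<s} w) * measure (Ber_inf (1 - e)) (cyl {s..<t} w)"
    using exists_fork_combination[OF laws[OF S], of "1 - e", OF _ _ h] e next_prob_bounds[OF P, of s]
    by auto
  have RC: "R \<in> C" using fork[OF R S] e by simp
  \<comment> \<open>Forking at \<open>Suc s\<close> rather than \<open>s\<close> keeps the bit just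
    drawn; with \<open>h = 0\<close> everything later comes from \<open>Ber_inf e\<close>, which
    restores the form of the induction hypothesis.\<close>
  obtain R' where R': "fork_combination R (Ber_inf e) R'"
    and R'_le: "\<And>t w. t \<le> Suc s \<Longrightarrow> measure R' (cyl {..<t} w) = measure R (cyl {..<t} w)"
    and R'_gt: "\<And>t w. Suc s < t \<Longrightarrow> measure R' (cyl {..<t} w) =
       0 * measure R (cyl {..<t} w) +
       (1 - 0) * measure R (cyl {..<Suc s} w) * measure (Ber_inf e) (cyl {Suc s..<t} w)"
    using exists_fork_combination[OF laws[OF RC] e, of "\<lambda>_. 0" "Suc s"] by auto
  have R_cyl: "measure R (cyl {..<t} w) = approx_prob P e t w" if "t \<le> Suc s" for t w
  proof (cases "t \<le> s")
    case True
    thus ?thesis by (simp add: R_le S_cyl measure_Ber_inf_cyl min_absorb2)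
  next
    case False
    with that have "t = Suc s" by simp
    thus ?thesis by (simp add: R_gt S_cyl measure_Ber_inf_cyl algebra_simps)
  qed
  have "measure R' (cyl {..<t} w) =
      approx_prob P e (min (Suc s) t) w * measure (Ber_inf e) (cyl {Suc s..<t} w)" for t w
  proof (cases "t \<le> Suc s")
    case True
    thus ?thesis using R'_le[OF True] R_cyl[OF True]
      by (simp add: measure_Ber_inf_cyl min_absorb2 del: approx_prob.simps)
  next
    case False
    hence "Suc s < t" by simp
    thus ?thesis using R'_gt[of t w] R_cyl[of "Suc s" w]
      by (simp add: min_absorb1 del: approx_prob.simps)
  qed
  moreover have "R' \<in> C" by (rule fork[OF R' RC e])
  ultimately show ?case by blast
qed

lemma approx_prob_tendsto:
  assumes P: "P \<in> laws" and e: "e \<longlonglongrightarrow> 0" "\<And>n. 0 < e n" "\<And>n. e n < 1"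
  shows "(\<lambda>n. approx_prob P (e n) t w) \<longlonglongrightarrow> measure P (cyl {..<t} w)"
proof (induction t)
  case 0
  interpret prob_space P using P by (rule laws_prob_space)
  show ?case using prob_space by (simp add: cyl_empty laws_space[OF P])
next
  case (Suc t)
  let ?q = "next_prob P t w"
  \<comment> \<open>The mass function has this form for parameters in the unit interval, whence the
    bounds on \<open>e\<close>.\<close>
  have pmf: "pmf (bernoulli_pmf (1 - e n)) b = (if b then 1 - e n else e n)"
    "pmf (bernoulli_pmf (e n)) b = (if b then e n else 1 - e n)" for n b
    using e(2,3)[of n] by (cases b; simp)+
  have "(\<lambda>n. ?q * (if w t then 1 - e n else e n) + (1 - ?q) * (if w t then e n else 1 - e n))
      \<longlonglongrightarrow> ?q * (if w t then 1 - 0 else 0) + (1 - ?q) * (if w t then 0 else 1 - 0)"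
    by (cases "w t") (simp_all only: if_True if_False, (intro tendsto_intros e(1))+)
  from tendsto_mult[OF Suc this] show ?case
    unfolding measure_cyl_Suc[OF P] by (simp add: pmf split: if_splits)
qed

lemma borel_measurable_LR:
  assumes "P \<in> laws" "R \<in> laws"
  shows "LR P t \<in> borel_measurable R"
proof (rule measurable_from_subalg[OF subalgebra_Filt[OF assms(2)]])
  show "LR P t \<in> borel_measurable (Filt t)"
  proof (rule measurable_FiltI)
    fix w \<omega> assume "\<omega> \<in> cyl {..<t} w"
    hence "cyl {..<t} \<omega> = cyl {..<t} w" by (auto simp: mem_cyl intro!: cyl_cong)
    thus "LR P t \<omega> = LR P t w" by (simp add: LR_eq[OF assms(1)])
  qed simp
qed

text \<open>At a fixed time \<open>t\<close> likelihood ratios lie between 0 and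
  \<open>2 ^ t\<close>, so dominated convergence upgrades convergence of cylinder probabilities to
  L1 convergence.\<close>

lemma in_closed_fork_convex_hull:
  assumes P: "P \<in> laws"
  shows "P \<in> closed_fork_convex_hull {Ber_inf p | p. 0 < p \<and> p < 1}"
proof -
  let ?Q = "{Ber_inf p | p. 0 < p \<and> p < 1}"
  have C: "fork_convex (fork_convex hull ?Q)"
    by (rule fork_convex_hull_fork_convex) (auto intro: Ber_inf_in_laws)
  have Ber: "Ber_inf p \<in> fork_convex hull ?Q" if "0 < p" "p < 1" for p
    using that hull_subset[of ?Q fork_convex] by blast
  \<comment> \<open>The offset 2 keeps every \<open>e n\<close>, including \<open>e 0 = 1/2\<close>,
    strictly inside the unit interval.\<close>
  define e where "e n = inverse (real (Suc (Suc n)))" for n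
  have e: "e \<longlonglongrightarrow> 0" "\<And>n. 0 < e n" "\<And>n. e n < 1"
    unfolding e_def using LIMSEQ_Suc[OF LIMSEQ_inverse_real_of_nat] by (auto simp: inverse_eq_divide)
  \<comment> \<open>One index drives both limits: the law chosen for \<open>n\<close> imitates
    \<open>n\<close> bits with error \<open>e n\<close>.\<close>
  have "\<forall>n. \<exists>S \<in> fork_convex hull ?Q. \<forall>t w. measure S (cyl {..<t} w) =
      approx_prob P (e n) (min n t) w * measure (Ber_inf (e n)) (cyl {n..<t} w)"
    using exists_approx_law[OF C Ber P e(2,3)] by blast
  then obtain S where S: "\<And>n. S n \<in> fork_convex hull ?Q"
    and S_cyl: "\<And>n t w. measure (S n) (cyl {..<t} w) =
      approx_prob P (e n) (min n t) w * measure (Ber_inf (e n)) (cyl {n..<t} w)" by metis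
  have S_laws: "S n \<in> laws" for n
    using C S unfolding fork_convex_def by blast
  have LR_bound: "0 \<le> LR R t w \<and> LR R t w \<le> 2 ^ t" if "R \<in> laws" for R t w
    using prob_space.prob_le_1[OF laws_prob_space[OF that]] by (simp add: LR_eq[OF that])
  have "(\<lambda>n. \<integral>\<^sup>+\<omega>. ennreal \<bar>LR (S n) t \<omega> - LR P t \<omega>\<bar> \<partial>Ref) \<longlonglongrightarrow> 0" for t
  proof -
    interpret Ref: prob_space Ref by (rule laws_prob_space[OF Ber_inf_in_laws])
    note [measurable] = borel_measurable_LR[OF _ Ber_inf_in_laws] S_laws P
    have "(\<lambda>n. \<integral>\<^sup>+\<omega>. ennreal \<bar>LR (S n) t \<omega> - LR P t \<omega>\<bar> \<partial>Ref) \<longlonglongrightarrow> (\<integral>\<^sup>+\<omega>. 0 \<partial>Ref)"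
    proof (rule nn_integral_dominated_convergence)
      show "AE w in Ref. ennreal \<bar>LR (S n) t w - LR P t w\<bar> \<le> ennreal (2 ^ t)" for n
      proof (intro AE_I2 ennreal_leI)
        fix w show "\<bar>LR (S n) t w - LR P t w\<bar> \<le> 2 ^ t"
          using LR_bound[OF S_laws[of n], of t w] LR_bound[OF P, of t w] by linarith
      qed
      show "AE w in Ref. (\<lambda>n. ennreal \<bar>LR (S n) t w - LR P t w\<bar>) \<longlonglongrightarrow> 0"
      proof (intro AE_I2)
        fix w
        \<comment> \<open>Once \<open>n \<ge> t\<close>, the prefix of length \<open>t\<close> lies
          in the imitated part and the tail factor is 1.\<close>
        have "eventually (\<lambda>n. approx_prob P (e n) t w = measure (S n) (cyl {..<t} w)) sequentially"
          using eventually_ge_at_top[of t]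
          by eventually_elim (simp add: S_cyl min_absorb2 measure_Ber_inf_cyl)
        from Lim_transform_eventually[OF approx_prob_tendsto[OF P e] this]
        have "(\<lambda>n. measure (S n) (cyl {..<t} w)) \<longlonglongrightarrow> measure P (cyl {..<t} w)" .
        hence "(\<lambda>n. LR (S n) t w) \<longlonglongrightarrow> LR P t w"
          unfolding LR_eq[OF S_laws] LR_eq[OF P] by (rule tendsto_mult_left)
        hence "(\<lambda>n. ennreal \<bar>LR (S n) t w - LR P t w\<bar>) \<longlonglongrightarrow> ennreal 0"
          by (intro tendsto_ennrealI tendsto_rabs_zero) (simp add: LIM_zero_iff)
        thus "(\<lambda>n. ennreal \<bar>LR (S n) t w - LR P t w\<bar>) \<longlonglongrightarrow> 0" by simp
      qed
    qed (simp_all add: borel_measurable_LR[OF _ Ber_inf_in_laws] S_laws P Ref.emeasure_space_1 ennreal_mult_less_top)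
    thus ?thesis by simp
  qed
  thus ?thesis
    unfolding closed_fork_convex_hull_def LR_closure_def using P S by blast
qed

section \<open>Martingales and supermartingales under all biases\<close>

text \<open>The cylinder has positive mass, so no null set covers it. Relations between
  \<open>Filt s\<close>-measurable functions, which are constant on it, thereby pass from almost
  everywhere to everywhere.\<close>

lemma ex_cyl_if_AE:
  assumes p: "0 < p" "p < 1" and ae: "AE \<omega> in Ber_inf p. \<phi> \<omega>"
  shows "\<exists>\<omega>\<in>cyl {..<s} w. \<phi> \<omega>"
proof (rule ccontr)
  assume "\<not> ?thesis"
  hence "AE \<omega> in Ber_inf p. \<omega> \<notin> cyl {..<s} w"
    using ae by (auto elim!: eventually_mono)
  moreover have "cyl {..<s} w \<in> sets (Ber_inf p)"
    by (simp add: laws_sets[OF Ber_inf_in_laws] sets_cyl)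
  ultimately have "emeasure (Ber_inf p) (cyl {..<s} w) = 0"
    by (simp add: AE_iff_null_sets null_setsD1)
  thus False using measure_Ber_inf_cyl_pos[OF p, of "{..<s}" w] by (simp add: measure_def)
qed

text \<open>On the cylinder of \<open>w\<close> up to \<open>s\<close> the conditional expectation
  is constant, while \<open>f\<close> takes one value on each of two subcylinders of relative mass
  \<open>p\<close> and \<open>1 - p\<close>. Equating the integrals and cancelling the positive mass
  gives an identity at every point.\<close>

lemma nn_cond_exp_Ber_inf:
  fixes f :: "bseq \<Rightarrow> real"
  assumes p: "0 < p" "p < 1" and f: "f \<in> borel_measurable (Filt (Suc s))" "\<And>\<omega>. 0 \<le> f \<omega>"
  shows "nn_cond_exp (Ber_inf p) (Filt s) (\<lambda>\<omega>. ennreal (f \<omega>)) w =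
    ennreal (p * f (w(s := True)) + (1 - p) * f (w(s := False)))"
proof -
  let ?B = "Ber_inf p" and ?D = "cyl {..<s} w"
  let ?T = "cyl {..<Suc s} (w(s := True))" and ?F = "cyl {..<Suc s} (w(s := False))"
  let ?E = "nn_cond_exp ?B (Filt s) (\<lambda>\<omega>. ennreal (f \<omega>))"
  interpret prob_space ?B by (rule laws_prob_space[OF Ber_inf_in_laws])
  interpret finite_measure_subalgebra ?B "Filt s"
    by unfold_locales (rule subalgebra_Filt[OF Ber_inf_in_laws])
  have sets: "cyl {..<t} v \<in> events" for t v
    by (simp add: laws_sets[OF Ber_inf_in_laws] sets_cyl)
  have fB: "f \<in> borel_measurable ?B"
    by (rule measurable_from_subalg[OF subalgebra_Filt[OF Ber_inf_in_laws] f(1)])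
  have Suc: "emeasure ?B (cyl {..<Suc s} (w(s := b))) =
      emeasure ?B ?D * ennreal (if b then p else 1 - p)" for b
  proof -
    have "prob (cyl {..<s} (w(s := b))) = prob ?D"
      by (rule arg_cong[where f = prob], rule cyl_cong) auto
    moreover have "prob (cyl {s..<Suc s} (w(s := b))) = (if b then p else 1 - p)"
      unfolding measure_Ber_inf_cyl[OF finite_atLeastLessThan] using p by (cases b) auto
    ultimately show ?thesis
      using measure_Ber_inf_cyl_split[of s "Suc s" p "w(s := b)"]
      using p by (simp add: emeasure_eq_measure ennreal_mult)
  qed
  have "?E w * emeasure ?B ?D = (\<integral>\<^sup>+\<omega>. ?E w * indicator ?D \<omega> \<partial>?B)"
    by (rule nn_integral_cmult_indicator[OF sets, symmetric])
  also have "\<dots> = (\<integral>\<^sup>+\<omega>. indicator ?D \<omega> * ?E \<omega> \<partial>?B)"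
  proof (rule nn_integral_cong)
    fix \<omega>
    have "?E \<omega> = ?E w" if "\<omega> \<in> ?D"
      by (rule measurable_FiltD[OF borel_measurable_nn_cond_exp that])
    thus "?E w * indicator ?D \<omega> = indicator ?D \<omega> * ?E \<omega>" by (simp add: indicator_def)
  qed
  also have "\<dots> = (\<integral>\<^sup>+\<omega>. indicator ?D \<omega> * ennreal (f \<omega>) \<partial>?B)"
    using fB by (intro nn_cond_exp_intg borel_measurable_indicator sets_Filt_cyl) simp
  also have "\<dots> = (\<integral>\<^sup>+\<omega>. ennreal (f (w(s := True))) * indicator ?T \<omega> +
      ennreal (f (w(s := False))) * indicator ?F \<omega> \<partial>?B)"
  proof (rule nn_integral_cong)
    fix \<omega>
    have "f \<omega> = f (w(s := \<omega> s))" if "\<omega> \<in> ?D"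
      using that by (intro measurable_FiltD[OF f(1)]) (auto simp: cyl_Suc_upd)
    thus "indicator ?D \<omega> * ennreal (f \<omega>) = ennreal (f (w(s := True))) * indicator ?T \<omega> +
      ennreal (f (w(s := False))) * indicator ?F \<omega>"
      by (cases "\<omega> s") (auto simp: cyl_Suc_upd split: split_indicator)
  qed
  also have "\<dots> = ennreal (f (w(s := True))) * emeasure ?B ?T + ennreal (f (w(s := False))) * emeasure ?B ?F"
    using sets by (subst nn_integral_add) (auto simp: nn_integral_cmult_indicator)
  also have "\<dots> = ennreal (p * f (w(s := True)) + (1 - p) * f (w(s := False))) * emeasure ?B ?D"
    unfolding Suc using p f(2) by (simp add: ennreal_mult distrib_left mult_ac)
  finally show ?thesis
    using measure_Ber_inf_cyl_pos[OF p, of "{..<s}" w]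
    by (simp add: ennreal_mult_cancel_left emeasure_eq_measure mult.commute[of _ "ennreal (prob ?D)"])
qed

lemma NSM_step:
  assumes M: "is_NSM {Ber_inf p | p. 0 < p \<and> p < 1} M"
  shows "M (Suc s) w \<le> M s w"
proof -
  have meas: "M t \<in> borel_measurable (Filt t)" and nn: "0 \<le> M t \<omega>" for t \<omega>
    using M by (auto simp: is_NSM_def nonneg_unit_process_def)
  have avg: "p * M (Suc s) (w(s := True)) + (1 - p) * M (Suc s) (w(s := False)) \<le> M s w"
    if p: "0 < p" "p < 1" for p
  proof -
    have "AE \<omega> in Ber_inf p. nn_cond_exp (Ber_inf p) (Filt s) (\<lambda>\<omega>. ennreal (M (Suc s) \<omega>)) \<omega> \<le> ennreal (M s \<omega>)"
      using M p le_SucI[OF order_refl, of s] unfolding is_NSM_def by blast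
    from ex_cyl_if_AE[OF p this, of s w] obtain \<omega> where \<omega>: "\<omega> \<in> cyl {..<s} w"
      and le: "nn_cond_exp (Ber_inf p) (Filt s) (\<lambda>\<omega>. ennreal (M (Suc s) \<omega>)) \<omega> \<le> ennreal (M s \<omega>)"
      by blast
    have "nn_cond_exp (Ber_inf p) (Filt s) (\<lambda>\<omega>. ennreal (M (Suc s) \<omega>)) w \<le> ennreal (M s w)"
      using le unfolding measurable_FiltD[OF meas \<omega>] measurable_FiltD[OF borel_measurable_nn_cond_exp \<omega>] .
    thus ?thesis unfolding nn_cond_exp_Ber_inf[OF p meas nn] using nn by simp
  qed
  have "M (Suc s) (w(s := True)) \<le> M s w"
  \<comment> \<open>Bounding \<open>p\<close> times the left side for all \<open>p\<close> in
    \<open>(0,1)\<close> replaces the limit \<open>p\<close> to 1; nonnegativity lets the other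
    branch be dropped from the average.\<close>
  proof (rule field_le_mult_one_interval)
    fix p :: real assume p: "0 < p" "p < 1"
    have "0 \<le> (1 - p) * M (Suc s) (w(s := False))" using p nn by simp
    thus "p * M (Suc s) (w(s := True)) \<le> M s w" using avg[OF p] by linarith
  qed
  moreover have "M (Suc s) (w(s := False)) \<le> M s w"
  proof (rule field_le_mult_one_interval)
    fix p :: real assume p: "0 < p" "p < 1"
    have "0 \<le> (1 - p) * M (Suc s) (w(s := True))" using p nn by simp
    \<comment> \<open>The bias \<open>1 - p\<close> gives the \<open>False\<close> branch the weight
      \<open>p\<close>.\<close>
    thus "p * M (Suc s) (w(s := False)) \<le> M s w" using avg[of "1 - p"] p by simp
  qed
  moreover have "w = w(s := True) \<or> w = w(s := False)" by (metis (full_types) fun_upd_triv)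
  ultimately show ?thesis by metis
qed

lemma NSM_antimono:
  assumes "is_NSM {Ber_inf p | p. 0 < p \<and> p < 1} M" "s \<le> t"
  shows "M t \<omega> \<le> M s \<omega>"
  using assms(2) lift_Suc_antimono_le[of "\<lambda>t. M t \<omega>"] NSM_step[OF assms(1)] by blast

lemma NM_imp_NSM: "is_NM \<Q> M \<Longrightarrow> is_NSM \<Q> M"
  unfolding is_NM_def is_NSM_def by (blast intro: eventually_mono eq_refl)

text \<open>Under the fair coin the two successor values average to 1, and neither exceeds 1 by the
  supermartingale bound, so both equal 1.\<close>

lemma NM_eq_1:
  assumes M: "is_NM {Ber_inf p | p. 0 < p \<and> p < 1} M"
  shows "M t w = 1"
proof (induction t arbitrary: w)
  case 0
  show ?case using M by (simp add: is_NM_def nonneg_unit_process_def)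
next
  case (Suc s)
  have meas: "M t \<in> borel_measurable (Filt t)" and nn: "0 \<le> M t \<omega>" for t \<omega>
    using M by (auto simp: is_NM_def nonneg_unit_process_def)
  let ?E = "nn_cond_exp Ref (Filt s) (\<lambda>\<omega>. ennreal (M (Suc s) \<omega>))"
  have "Ref \<in> {Ber_inf p | p. 0 < p \<and> p < 1}" by auto
  hence "AE \<omega> in Ref. ?E \<omega> = ennreal (M s \<omega>)"
    using M le_SucI[OF order_refl, of s] unfolding is_NM_def by blast
  from ex_cyl_if_AE[OF _ _ this, of s w] obtain \<omega> where \<omega>: "\<omega> \<in> cyl {..<s} w"
    and eq: "?E \<omega> = ennreal (M s \<omega>)" by auto
  have "?E w = 1"
    using eq Suc unfolding measurable_FiltD[OF borel_measurable_nn_cond_exp \<omega>] by simp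
  hence avg: "M (Suc s) (w(s := True)) / 2 + M (Suc s) (w(s := False)) / 2 = 1"
    using nn_cond_exp_Ber_inf[of "1/2" "M (Suc s)" s w, OF _ _ meas nn] by simp
  have "M (Suc s) v \<le> 1" for v
    using NSM_step[OF NM_imp_NSM[OF M], of s v] Suc by simp
  from this[of "w(s := True)"] this[of "w(s := False)"]
  have "M (Suc s) (w(s := True)) = 1 \<and> M (Suc s) (w(s := False)) = 1"
    using avg by auto
  moreover have "w = w(s := True) \<or> w = w(s := False)" by (metis (full_types) fun_upd_triv)
  ultimately show ?case by metis
qed

lemma one_is_NM:
  assumes "\<Q> \<subseteq> laws" "\<And>t \<omega>. M t \<omega> = 1"
  shows "is_NM \<Q> M"
  unfolding is_NM_def
proof (intro conjI ballI allI impI)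
  have M: "M t = (\<lambda>_. 1)" for t using assms(2) by auto
  show "nonneg_unit_process M" by (simp add: nonneg_unit_process_def M)
  fix Q and s t :: nat assume Q: "Q \<in> \<Q>"
  hence "Q \<in> laws" using assms(1) by blast
  interpret prob_space Q using \<open>Q \<in> laws\<close> by (rule laws_prob_space)
  interpret finite_measure_subalgebra Q "Filt s"
    by unfold_locales (rule subalgebra_Filt[OF \<open>Q \<in> laws\<close>])
  have "AE \<omega> in Q. (1::ennreal) = nn_cond_exp Q (Filt s) (\<lambda>_. 1) \<omega>"
    by (rule nn_cond_exp_F_meas) simp
  thus "AE \<omega> in Q. nn_cond_exp Q (Filt s) (\<lambda>\<omega>. ennreal (M t \<omega>)) \<omega> = ennreal (M s \<omega>)"
    unfolding M ennreal_1 by (rule eventually_mono) (rule sym)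
qed

theorem theorem17:
  fixes \<Q> :: "bseq measure set"
  assumes \<Q>_def: "\<Q> = {Ber_inf p | p. 0 < p \<and> p < 1}"
  shows "(\<forall>P \<in> laws. P \<in> closed_fork_convex_hull \<Q>)
    \<and> (\<forall>M. is_NM \<Q> M \<longleftrightarrow> (\<forall>t \<omega>. M t \<omega> = 1))
    \<and> (\<forall>M. is_NSM \<Q> M \<longrightarrow> (\<forall>s t \<omega>. s \<le> t \<longrightarrow> M t \<omega> \<le> M s \<omega>))
    \<and> (\<forall>M. is_NSM \<Q> M \<longrightarrow> (\<forall>t \<omega>. M t \<omega> \<le> 1))
    \<and> (\<forall>M. is_NSM \<Q> M \<longrightarrow> (\<forall>P \<in> laws. \<forall>\<alpha>. 0 < \<alpha> \<and> \<alpha> < 1 \<longrightarrow>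
          {\<omega> \<in> space P. (INF t \<in> {t. 1 \<le> t \<and> 1 / \<alpha> \<le> M t \<omega>}. enat t) < \<infinity>} \<in> null_sets P))"
proof -
  have le1: "M t \<omega> \<le> 1" if "is_NSM \<Q> M" for M t \<omega>
  proof -
    have "M t \<omega> \<le> M 0 \<omega>" using NSM_antimono that unfolding \<Q>_def by blast
    also have "M 0 \<omega> = 1" using that by (simp add: is_NSM_def nonneg_unit_process_def)
    finally show ?thesis .
  qed
  have null: "{\<omega> \<in> space P. (INF t \<in> {t. 1 \<le> t \<and> 1 / \<alpha> \<le> M t \<omega>}. enat t) < \<infinity>} \<in> null_sets P"
    if "is_NSM \<Q> M" "0 < \<alpha>" "\<alpha> < 1" for P \<alpha> and M :: "nat \<Rightarrow> bseq \<Rightarrow> real"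
  proof -
    \<comment> \<open>Values at most 1 never reach the level \<open>1 / \<alpha>\<close>, so the
      infimum is over the empty set, hence infinite, and the event is empty, not merely
      null.\<close>
    have "M t \<omega> < 1 / \<alpha>" for t \<omega>
      using le1[OF that(1), of t \<omega>] that(2,3) by (smt (verit) less_divide_eq_1_pos)
    hence "{t. 1 \<le> t \<and> 1 / \<alpha> \<le> M t \<omega>} = {}" for \<omega> by (auto simp: not_le)
    thus ?thesis by (simp only: image_empty Inf_empty) (simp add: top_enat_def)
  qed
  have "\<Q> \<subseteq> laws" using Ber_inf_in_laws by (auto simp: \<Q>_def)
  hence NM: "is_NM \<Q> M \<longleftrightarrow> (\<forall>t \<omega>. M t \<omega> = 1)" for M
    using NM_eq_1 one_is_NM unfolding \<Q>_def by blast
  show ?thesis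
  proof (intro conjI ballI allI impI)
    show "P \<in> closed_fork_convex_hull \<Q>" if "P \<in> laws" for P
      using in_closed_fork_convex_hull[OF that] by (simp only: \<Q>_def)
    show "M t \<omega> \<le> M s \<omega>" if "is_NSM \<Q> M" "s \<le> t" for M s t \<omega>
      using NSM_antimono that by (simp only: \<Q>_def)
  qed (simp_all only: NM le1 null)
qed

end
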